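(* Let $\mathcal{G}$ be a connected edge-weighted graph (as in the context), with the metric $d$. Every function $f:\mathcal{V}\to\mathbb{R}$ with $B(f,f)<\infty$ is uniformly continuous on $\mathcal{G}$ (with respect to $d$), and so $f$ extends uniquely to a continuous function on $\overline{\mathcal{G}}$.
   Context: Graphs. $\mathcal{G}$ is a simple graph with countable vertex set $\mathcal{V}$ and countable edge set $\mathcal{E}$; each vertex has at least one and at most finitely many incident edges. Each edge $[u,v]\in\mathcal{E}$ has a length $R(u,v)=R(v,u)\in(0,\infty)$; $C(u,v)=1/R(u,v)$ for edges and $C(u,v)=0$ otherwise. $u\sim v$ means $[u,v]\in\mathcal{E}$. Metric and completion. A finite path from $u$ to $v$ is a finite sequence of vertices $u=v_0,\dots,v_K=v$ with $[v_k,v_{k+1}]\in\mathcal{E}$. $\mathcal{G}$ is connected if any two vertices are joined by a finite path. $d(u,v)=\inf_\gamma\sum_k R(v_k,v_{k+1})$, the infimum over finite paths $\gamma$ from $u$ to $v$. As a metric space $\mathcal{G}$ is identified with its vertex set, and $\overline{\mathcal{G}}$ is the metric completion. Form. $B(f,f)=\frac12\sum_{v\in\mathcal{V}}\sum_{u\sim v}C(u,v)(f(v)-f(u))^2\in[0,\infty]$. *)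

theory Defs
  imports "HOL-Analysis.Analysis"
begin

text \<open>
  A graph has a vertex set \<open>V\<close> and a set \<open>E\<close> of two-element sets of vertices as edges;
  \<open>R u v\<close> is the length of the edge \<open>{u, v}\<close>, and its values off the edges are irrelevant.
\<close>

locale weighted_graph =
  fixes V :: "'a set" and E :: "'a set set" and R :: "'a \<Rightarrow> 'a \<Rightarrow> real"
  assumes countable_V: "countable V"
    and countable_E: "countable E"
    and simple: "\<And>e. e \<in> E \<Longrightarrow> \<exists>u v. u \<in> V \<and> v \<in> V \<and> u \<noteq> v \<and> e = {u, v}"
    and incident_nonempty: "\<And>v. v \<in> V \<Longrightarrow> {e \<in> E. v \<in> e} \<noteq> {}"
    and incident_finite: "\<And>v. v \<in> V \<Longrightarrow> finite {e \<in> E. v \<in> e}"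
    and R_sym: "\<And>u v. {u, v} \<in> E \<Longrightarrow> R u v = R v u"
    and R_pos: "\<And>u v. {u, v} \<in> E \<Longrightarrow> 0 < R u v"

text \<open>The one-vertex path (\<open>K = 0\<close>) is allowed, so that a vertex has distance 0 to itself.\<close>

definition is_path :: "'a set \<Rightarrow> 'a set set \<Rightarrow> 'a \<Rightarrow> 'a list \<Rightarrow> 'a \<Rightarrow> bool" where
  "is_path V E u p v \<longleftrightarrow> p \<noteq> [] \<and> hd p = u \<and> last p = v \<and> set p \<subseteq> V \<and>
     (\<forall>k < length p - 1. {p ! k, p ! Suc k} \<in> E)"

definition path_length :: "('a \<Rightarrow> 'a \<Rightarrow> real) \<Rightarrow> 'a list \<Rightarrow> real" where
  "path_length R p = (\<Sum>k < length p - 1. R (p ! k) (p ! Suc k))"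

locale connected_weighted_graph = weighted_graph +
  assumes connected: "\<And>u v. u \<in> V \<Longrightarrow> v \<in> V \<Longrightarrow> \<exists>p. is_path V E u p v"

text \<open>
  The value 0 off \<open>V\<close> is only needed because \<^locale>\<open>Metric_space\<close> demands symmetry and
  nonnegativity outside the carrier as well.
\<close>

definition graph_dist ::
    "'a set \<Rightarrow> 'a set set \<Rightarrow> ('a \<Rightarrow> 'a \<Rightarrow> real) \<Rightarrow> 'a \<Rightarrow> 'a \<Rightarrow> real" where
  "graph_dist V E R u v =
     (if u \<in> V \<and> v \<in> V then INF p \<in> {p. is_path V E u p v}. path_length R p else 0)"

definition graph_metric :: "'a set \<Rightarrow> 'a set set \<Rightarrow> ('a \<Rightarrow> 'a \<Rightarrow> real) \<Rightarrow> 'a metric" where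
  "graph_metric V E R = metric (V, graph_dist V E R)"

definition conductance :: "'a set set \<Rightarrow> ('a \<Rightarrow> 'a \<Rightarrow> real) \<Rightarrow> 'a \<Rightarrow> 'a \<Rightarrow> real" where
  "conductance E R u v = (if {u, v} \<in> E then 1 / R u v else 0)"

definition energy ::
    "'a set \<Rightarrow> 'a set set \<Rightarrow> ('a \<Rightarrow> 'a \<Rightarrow> real) \<Rightarrow> ('a \<Rightarrow> real) \<Rightarrow> ennreal" where
  "energy V E R f =
     (\<Sum>\<^sub>\<infinity>v\<in>V. \<Sum>\<^sub>\<infinity>u\<in>{u. {u, v} \<in> E}. ennreal (conductance E R u v * (f v - f u)\<^sup>2)) / 2"

text \<open>
  \<open>\<iota>\<close> exhibits \<open>Y\<close> as a metric completion of \<open>X\<close>: a complete metric space together with an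
  isometry of \<open>X\<close> onto a dense subset.
\<close>

definition is_metric_completion :: "'a metric \<Rightarrow> 'b metric \<Rightarrow> ('a \<Rightarrow> 'b) \<Rightarrow> bool" where
  "is_metric_completion X Y \<iota> \<longleftrightarrow>
     mcomplete_of Y \<and> \<iota> \<in> mspace X \<rightarrow> mspace Y \<and>
     (\<forall>x \<in> mspace X. \<forall>y \<in> mspace X. mdist Y (\<iota> x) (\<iota> y) = mdist X x y) \<and>
     mtopology_of Y closure_of (\<iota> ` mspace X) = mspace Y"

lemma ex_metric_completion:
  fixes X :: "'a metric"
  shows "\<exists>(Y :: ('a \<Rightarrow> real) metric) \<iota>. is_metric_completion X Y \<iota>"
proof -
  interpret Metric_space "mspace X" "mdist X" by simp
  show ?thesis
    using metric_completion unfolding is_metric_completion_def by metis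
qed

lemma path_length_Cons2: "path_length R (x # y # p) = R x y + path_length R (y # p)"
  by (simp add: path_length_def sum.lessThan_Suc_shift del: sum.lessThan_Suc)

lemma is_path_Cons2:
  "is_path V E u (x # y # p) v \<longleftrightarrow> u = x \<and> x \<in> V \<and> {x, y} \<in> E \<and> is_path V E y (y # p) v"
  by (auto simp: is_path_def nth_Cons' less_Suc_eq_0_disj)

lemma is_path_singleton: "is_path V E u [x] v \<longleftrightarrow> u = x \<and> v = x \<and> x \<in> V"
  by (auto simp: is_path_def)

context weighted_graph
begin

lemma path_length_nonneg: "is_path V E u p v \<Longrightarrow> 0 \<le> path_length R p"
  unfolding path_length_def is_path_def by (intro sum_nonneg) (auto intro: less_imp_le R_pos)

lemma path_append:
  "is_path V E u p v \<Longrightarrow> is_path V E v q w \<Longrightarrow>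
    \<exists>r. is_path V E u r w \<and> path_length R r = path_length R p + path_length R q"
proof (induction p arbitrary: u rule: induct_list012)
  case 1
  then show ?case by (simp add: is_path_def)
next
  case (2 x)
  then show ?case by (auto simp: is_path_singleton path_length_def)
next
  case (3 x y p)
  from 3(3) have *: "u = x" "x \<in> V" "{x, y} \<in> E" "is_path V E y (y # p) v"
    by (auto simp: is_path_Cons2)
  from 3(2)[OF *(4) 3(4)] obtain r where
    r: "is_path V E y r w" "path_length R r = path_length R (y # p) + path_length R q"
    by blast
  from r(1) obtain r' where r': "r = y # r'"
    by (cases r) (auto simp: is_path_def)
  show ?case
    using * r by (intro exI[of _ "x # r"]) (auto simp: r' is_path_Cons2 path_length_Cons2)
qed

lemma path_rev:
  "is_path V E u p v \<Longrightarrow> \<exists>r. is_path V E v r u \<and> path_length R r = path_length R p"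
proof (induction p arbitrary: u rule: induct_list012)
  case 1
  then show ?case by (simp add: is_path_def)
next
  case (2 x)
  then show ?case by (intro exI[of _ "[x]"]) (auto simp: is_path_singleton)
next
  case (3 x y p)
  from 3(3) have *: "u = x" "x \<in> V" "{x, y} \<in> E" "is_path V E y (y # p) v"
    by (auto simp: is_path_Cons2)
  from 3(2)[OF *(4)] obtain r where
    r: "is_path V E v r y" "path_length R r = path_length R (y # p)"
    by blast
  have "y \<in> V" using *(4) by (auto simp: is_path_def)
  then have "is_path V E y [y, x] x"
    using * by (auto simp: is_path_Cons2 is_path_singleton insert_commute)
  moreover have "path_length R [y, x] = R x y"
    using R_sym[OF *(3)] by (simp add: path_length_def)
  ultimately show ?case
    using path_append[OF r(1), of "[y, x]" x] r(2) *(1)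
    by (auto simp: path_length_Cons2 add.commute)
qed

lemma path_length_lower:
  assumes "u \<in> V"
  obtains c where "0 < c" "\<And>p v. is_path V E u p v \<Longrightarrow> u \<noteq> v \<Longrightarrow> c \<le> path_length R p"
proof -
  let ?N = "{y. {u, y} \<in> E}"
  have "(\<lambda>y. {u, y}) ` ?N \<subseteq> {e \<in> E. u \<in> e}" by auto
  then have "finite ((\<lambda>y. {u, y}) ` ?N)"
    using incident_finite[OF assms] by (rule finite_subset)
  moreover have "inj_on (\<lambda>y. {u, y}) ?N"
    by (auto simp: inj_on_def doubleton_eq_iff)
  ultimately have fin: "finite ?N" by (rule finite_imageD)
  define c where "c = Min (insert 1 (R u ` ?N))"
  have c_le: "c \<le> R u y" if "{u, y} \<in> E" for y
    unfolding c_def using fin that by (intro Min_le) auto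
  have c_pos: "0 < c"
    unfolding c_def using fin by (subst Min_gr_iff) (auto intro: R_pos)
  have "c \<le> path_length R p" if p: "is_path V E u p v" "u \<noteq> v" for p v
  proof (cases p rule: remdups_adj.cases)
    case 1
    then show ?thesis using p by (simp add: is_path_def)
  next
    case (2 x)
    then show ?thesis using p by (simp add: is_path_singleton)
  next
    case (3 x y q)
    then show ?thesis
      using p c_le[of y] path_length_nonneg[of y "y # q" v]
      by (auto simp: is_path_Cons2 path_length_Cons2)
  qed
  with c_pos that show thesis by blast
qed

end

context connected_weighted_graph
begin

lemma graph_dist_le: "is_path V E u p v \<Longrightarrow> graph_dist V E R u v \<le> path_length R p"
proof -
  assume p: "is_path V E u p v"
  then have "u \<in> V" "v \<in> V"
    by (auto simp: is_path_def intro: hd_in_set last_in_set)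
  then show ?thesis
    unfolding graph_dist_def using p
    by (auto intro!: cINF_lower bdd_belowI2[where m = 0] dest: path_length_nonneg)
qed

lemma graph_dist_ge:
  assumes "u \<in> V" "v \<in> V" "\<And>p. is_path V E u p v \<Longrightarrow> c \<le> path_length R p"
  shows "c \<le> graph_dist V E R u v"
  unfolding graph_dist_def using assms connected[of u v] by (auto intro!: cINF_greatest)

lemma Metric_space_graph_dist: "Metric_space V (graph_dist V E R)"
proof
  have le: "graph_dist V E R u v \<le> graph_dist V E R v u" for u v
  proof (cases "u \<in> V \<and> v \<in> V")
    case True
    then show ?thesis using graph_dist_le path_rev by (intro graph_dist_ge) metis+
  qed (auto simp: graph_dist_def)
  show "graph_dist V E R u v = graph_dist V E R v u" for u v
    using le by (intro antisym)
  show nonneg: "0 \<le> graph_dist V E R u v" for u v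
  proof (cases "u \<in> V \<and> v \<in> V")
    case True
    then show ?thesis by (auto intro: graph_dist_ge path_length_nonneg)
  qed (auto simp: graph_dist_def)
  show "graph_dist V E R u v = 0 \<longleftrightarrow> u = v" if uv: "u \<in> V" "v \<in> V" for u v
  proof
    assume "u = v"
    then have "graph_dist V E R u v \<le> path_length R [u]"
      using uv by (intro graph_dist_le) (auto simp: is_path_singleton)
    then show "graph_dist V E R u v = 0"
      using nonneg[of u v] by (simp add: path_length_def)
  next
    assume 0: "graph_dist V E R u v = 0"
    show "u = v"
    proof (rule ccontr)
      assume "u \<noteq> v"
      obtain c where c: "0 < c" "\<And>p v. is_path V E u p v \<Longrightarrow> u \<noteq> v \<Longrightarrow> c \<le> path_length R p"
        using path_length_lower[OF uv(1)] by blast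
      have "c \<le> graph_dist V E R u v"
        using uv \<open>u \<noteq> v\<close> c(2) by (intro graph_dist_ge) auto
      with 0 c(1) show False by simp
    qed
  qed
  show "graph_dist V E R u w \<le> graph_dist V E R u v + graph_dist V E R v w"
    if "u \<in> V" "v \<in> V" "w \<in> V" for u v w
  proof -
    have "graph_dist V E R u w - path_length R p \<le> graph_dist V E R v w"
      if p: "is_path V E u p v" for p
    proof (rule graph_dist_ge[OF \<open>v \<in> V\<close> \<open>w \<in> V\<close>])
      fix q assume "is_path V E v q w"
      from path_append[OF p this] obtain r where
        "is_path V E u r w" "path_length R r = path_length R p + path_length R q"
        by blast
      with graph_dist_le show "graph_dist V E R u w - path_length R p \<le> path_length R q"
        by fastforce
    qed
    then have "graph_dist V E R u w - graph_dist V E R v w \<le> graph_dist V E R u v"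
      using that by (intro graph_dist_ge) (auto simp: algebra_simps)
    then show ?thesis by simp
  qed
qed

lemma mspace_graph_metric [simp]: "mspace (graph_metric V E R) = V"
  unfolding graph_metric_def using Metric_space_graph_dist by (rule Metric_space.mspace_metric)

lemma mdist_graph_metric [simp]: "mdist (graph_metric V E R) = graph_dist V E R"
  unfolding graph_metric_def using Metric_space_graph_dist by (rule Metric_space.mdist_metric)

end

end

theory Submission
  imports Defs
begin

text \<open>
  Deleting cycles does not lengthen a path, so the infimum defining \<open>d(u, v)\<close> may be taken over
  paths without repeated vertices. Such a path traverses each edge at most once, and
  Cauchy--Schwarz gives \<open>(f v - f u)\<^sup>2 \<le> 2 B(f, f) d(u, v)\<close>, whence \<open>f\<close> is uniformly continuous.
  Uniformly continuous maps into a complete space extend to the completion, uniquely because the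
  original space is dense.
\<close>

text \<open>An isometry is injective, so \<open>f\<close> can be carried over to the dense image of
  \<open>\<iota>\<close>. There it is uniformly continuous, hence Cauchy continuous, and a Cauchy
  continuous map into a complete space extends continuously to the closure.\<close>

lemma metric_completion_extension:
  fixes X :: "'a metric" and Y :: "'b metric" and Z :: "'c metric"
  assumes compl: "is_metric_completion X Y \<iota>" and Z: "mcomplete_of Z"
    and f: "uniformly_continuous_map X Z f"
  shows "\<exists>!g. g \<in> extensional (mspace Y) \<and>
    continuous_map (mtopology_of Y) (mtopology_of Z) g \<and> (\<forall>x \<in> mspace X. g (\<iota> x) = f x)"
proof -
  let ?S = "\<iota> ` mspace X"
  have iota: "\<And>x. x \<in> mspace X \<Longrightarrow> \<iota> x \<in> mspace Y"
    and iso: "\<And>x y. x \<in> mspace X \<Longrightarrow> y \<in> mspace X \<Longrightarrow> mdist Y (\<iota> x) (\<iota> y) = mdist X x y"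
    and dense: "mtopology_of Y closure_of ?S = mspace Y"
    using compl unfolding is_metric_completion_def by auto
  interpret X: Metric_space "mspace X" "mdist X" by simp
  interpret Z: Metric_space "mspace Z" "mdist Z" by simp
  have "inj_on \<iota> (mspace X)"
    using iso by (metis X.zero inj_onI)
  then have inv: "inv_into (mspace X) \<iota> (\<iota> x) = x" if "x \<in> mspace X" for x
    using that by simp
  have "uniformly_continuous_map (submetric Y ?S) Z (f \<circ> inv_into (mspace X) \<iota>)"
    unfolding uniformly_continuous_map_def
  proof (intro conjI allI impI)
    show "f \<circ> inv_into (mspace X) \<iota> \<in> mspace (submetric Y ?S) \<rightarrow> mspace Z"
      using uniformly_continuous_map_funspace[OF f] by (auto simp: inv)
    fix \<epsilon> :: real
    assume "0 < \<epsilon>"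
    then obtain \<delta> where "0 < \<delta>"
      "\<And>x y. x \<in> mspace X \<Longrightarrow> y \<in> mspace X \<Longrightarrow> mdist X y x < \<delta> \<Longrightarrow> mdist Z (f y) (f x) < \<epsilon>"
      using f unfolding uniformly_continuous_map_def by metis
    then show "\<exists>\<delta>>0. \<forall>x \<in> mspace (submetric Y ?S). \<forall>y \<in> mspace (submetric Y ?S).
        mdist (submetric Y ?S) y x < \<delta> \<longrightarrow>
        mdist Z ((f \<circ> inv_into (mspace X) \<iota>) y) ((f \<circ> inv_into (mspace X) \<iota>) x) < \<epsilon>"
      by (intro exI[of _ \<delta>]) (auto simp: inv iso)
  qed
  \<comment> \<open>Since the image of \<open>\<iota>\<close> is dense, its closure is all of
    \<open>mspace Y\<close>, so the extension lives on the whole completion.\<close>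
  then obtain g where
    g: "continuous_map (subtopology (mtopology_of Y) (mspace Y)) (mtopology_of Z) g"
       "\<forall>y \<in> ?S. g y = (f \<circ> inv_into (mspace X) \<iota>) y"
    using Cauchy_continuous_map_extends_to_continuous_closure_of[OF Z]
      uniformly_imp_Cauchy_continuous_map dense by metis
  \<comment> \<open>HOL functions are total, so continuity says nothing about values off
    \<open>mspace Y\<close>. Restricting \<open>g\<close> fixes them at \<open>undefined\<close>, as
    membership in \<open>extensional\<close> demands, which makes uniqueness literal.\<close>
  show ?thesis
  proof (rule ex1I[of _ "restrict g (mspace Y)"], intro conjI)
    have "continuous_map (mtopology_of Y) (mtopology_of Z) g"
      using g(1) by (metis subtopology_topspace topspace_mtopology_of)
    then show cont: "continuous_map (mtopology_of Y) (mtopology_of Z) (restrict g (mspace Y))"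
      by (rule continuous_map_eq) simp
    show val: "\<forall>x \<in> mspace X. restrict g (mspace Y) (\<iota> x) = f x"
      using g(2) iota inv by simp
    fix h
    assume h: "h \<in> extensional (mspace Y) \<and>
      continuous_map (mtopology_of Y) (mtopology_of Z) h \<and> (\<forall>x \<in> mspace X. h (\<iota> x) = f x)"
    have "h y = restrict g (mspace Y) y" if "y \<in> mspace Y" for y
    \<comment> \<open>Continuous maps into a Hausdorff space that agree on a dense set agree
      everywhere.\<close>
    proof (rule forall_in_closure_of_eq[where f = h and g = "restrict g (mspace Y)" and S = ?S])
      show "y \<in> mtopology_of Y closure_of ?S" using dense that by simp
      show "Hausdorff_space (mtopology_of Z)"
        using Z.Hausdorff_space_mtopology by (simp add: mtopology_of_def)
      show "h z = restrict g (mspace Y) z" if "z \<in> ?S" for z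
        using that h val by auto
    qed (use h cont in auto)
    then show "h = restrict g (mspace Y)"
      using h by (intro extensionalityI[of _ "mspace Y"]) auto
  qed auto
qed

context weighted_graph
begin

text \<open>The discarded initial edges all have positive length. This is the tool for cutting out a
  cycle.\<close>

lemma is_path_suffix:
  "is_path V E u (p @ x # q) v \<Longrightarrow>
    is_path V E x (x # q) v \<and> path_length R (x # q) \<le> path_length R (p @ x # q)"
proof (induction p arbitrary: u)
  case Nil
  then show ?case by (auto simp: is_path_def)
next
  case (Cons a p)
  obtain y r where r: "p @ x # q = y # r" by (cases p) auto
  then have edge: "{a, y} \<in> E" and path: "is_path V E y (p @ x # q) v"
    using Cons.prems by (auto simp: is_path_Cons2)
  with Cons.IH[OF path] R_pos[OF edge] show ?case
    by (auto simp: r path_length_Cons2)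
qed

text \<open>Induction along the path: the tail is made free of repetitions first, and only the new
  head can then be repeated.\<close>

lemma distinct_path:
  "is_path V E u p v \<Longrightarrow>
    \<exists>q. is_path V E u q v \<and> distinct q \<and> path_length R q \<le> path_length R p"
proof (induction p arbitrary: u rule: induct_list012)
  case 1
  then show ?case by (simp add: is_path_def)
next
  case (2 x)
  then show ?case by (intro exI[of _ "[x]"]) auto
next
  case (3 x y p)
  from 3(3) have *: "u = x" "x \<in> V" "{x, y} \<in> E" "is_path V E y (y # p) v"
    by (auto simp: is_path_Cons2)
  from 3(2)[OF *(4)] obtain q where
    q: "is_path V E y q v" "distinct q" "path_length R q \<le> path_length R (y # p)"
    by blast
  show ?case
  proof (cases "x \<in> set q")
    case True
    \<comment> \<open>The head \<open>x\<close> recurs in \<open>q\<close>, so going along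
      \<open>q\<close> back to \<open>x\<close> would close a cycle. The suffix from that occurrence
      already starts at \<open>x\<close>, inherits distinctness and is no longer than
      \<open>q\<close>.\<close>
    then obtain q1 q2 where q12: "q = q1 @ x # q2" by (auto simp: in_set_conv_decomp)
    with is_path_suffix[of y q1 x q2 v] q R_pos[OF *(3)] *(1) show ?thesis
      by (intro exI[of _ "x # q2"]) (auto simp: path_length_Cons2)
  next
    case False
    obtain r where "q = y # r"
      using q(1) by (cases q) (auto simp: is_path_def)
    with False q * show ?thesis
      by (intro exI[of _ "x # q"]) (auto simp: is_path_Cons2 path_length_Cons2)
  qed
qed

text \<open>Each step of the path is matched with one term of the double sum: outer index
  \<open>p ! Suc k\<close>, inner index \<open>p ! k\<close>. Distinctness prevents any term from
  being used twice. The factor 2 undoes the division by 2 in \<open>energy\<close>.\<close>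

lemma distinct_path_energy_le:
  assumes "is_path V E u p v" "distinct p"
  shows "ennreal (\<Sum>k < length p - 1. (f (p ! Suc k) - f (p ! k))\<^sup>2 / R (p ! k) (p ! Suc k))
    \<le> 2 * energy V E R f"
proof -
  let ?n = "length p - 1"
  let ?t = "\<lambda>w x. ennreal (conductance E R x w * (f w - f x)\<^sup>2)"
  let ?g = "\<lambda>w. \<Sum>\<^sub>\<infinity>x\<in>{x. {x, w} \<in> E}. ?t w x"
  have edge: "{p ! k, p ! Suc k} \<in> E" if "k < ?n" for k
    using assms(1) that by (auto simp: is_path_def)
  have sub: "(\<lambda>k. p ! Suc k) ` {..<?n} \<subseteq> V"
    using assms(1) by (auto simp: is_path_def)
  \<comment> \<open>The step targets are pairwise distinct, so the sum over \<open>k\<close> can be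
    reindexed as a sum over a set of vertices and compared with the outer sum over
    \<open>V\<close>.\<close>
  have inj: "inj_on (\<lambda>k. p ! Suc k) {..<?n}"
    using assms(2) by (auto simp: inj_on_def nth_eq_iff_index_eq)
  have term_le: "ennreal ((f (p ! Suc k) - f (p ! k))\<^sup>2 / R (p ! k) (p ! Suc k)) \<le> ?g (p ! Suc k)"
    if "k < ?n" for k
  proof -
    \<comment> \<open>Writing the term as a sum over a singleton reduces the bound to monotonicity
      of nonnegative sums in the index set.\<close>
    have "ennreal ((f (p ! Suc k) - f (p ! k))\<^sup>2 / R (p ! k) (p ! Suc k))
      = infsum (?t (p ! Suc k)) {p ! k}"
      using edge[OF that] by (simp add: conductance_def)
    also have "\<dots> \<le> ?g (p ! Suc k)"
      using edge[OF that] by (intro infsum_mono_neutral nonneg_summable_on_complete) auto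
    finally show ?thesis .
  qed
  have "ennreal (\<Sum>k < ?n. (f (p ! Suc k) - f (p ! k))\<^sup>2 / R (p ! k) (p ! Suc k))
    = (\<Sum>k < ?n. ennreal ((f (p ! Suc k) - f (p ! k))\<^sup>2 / R (p ! k) (p ! Suc k)))"
    using R_pos[OF edge] by (intro sum_ennreal[symmetric]) (simp add: less_imp_le)
  also have "\<dots> \<le> (\<Sum>k < ?n. ?g (p ! Suc k))"
    using term_le by (intro sum_mono) auto
  also have "\<dots> = infsum ?g ((\<lambda>k. p ! Suc k) ` {..<?n})"
    using inj by (simp add: sum.reindex)
  also have "\<dots> \<le> infsum ?g V"
    using sub by (intro infsum_mono_neutral nonneg_summable_on_complete) auto
  also have "\<dots> = 2 * energy V E R f"
    unfolding energy_def ennreal_times_divide mult.commute[of 2] by (simp add: ennreal_mult_divide_eq)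
  finally show ?thesis .
qed

lemma path_diff_square_le:
  assumes "energy V E R f < \<infinity>" "is_path V E u p v"
  shows "(f v - f u)\<^sup>2 \<le> 2 * enn2real (energy V E R f) * path_length R p"
proof -
  obtain q where q: "is_path V E u q v" "distinct q" "path_length R q \<le> path_length R p"
    using distinct_path[OF assms(2)] by blast
  let ?n = "length q - 1"
  let ?D = "\<lambda>k. f (q ! Suc k) - f (q ! k)"
  let ?R = "\<lambda>k. R (q ! k) (q ! Suc k)"
  have pos: "0 < ?R k" if "k < ?n" for k
    using q(1) that by (auto simp: is_path_def intro: R_pos)
  have "f v - f u = (\<Sum>k < ?n. ?D k)"
    using q(1) sum_lessThan_telescope[of "\<lambda>k. f (q ! k)" ?n]
    by (auto simp: is_path_def hd_conv_nth last_conv_nth)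
  \<comment> \<open>Weighting by \<open>sqrt (?R k)\<close> makes Cauchy-Schwarz split the sum into
    an energy factor and the length of \<open>q\<close>.\<close>
  also have "\<dots> = (\<Sum>k < ?n. ?D k / sqrt (?R k) * sqrt (?R k))"
  proof (rule sum.cong[OF refl])
    show "?D k = ?D k / sqrt (?R k) * sqrt (?R k)" if "k \<in> {..<?n}" for k
      using that pos[of k] by simp
  qed
  finally have sum: "f v - f u = (\<Sum>k < ?n. ?D k / sqrt (?R k) * sqrt (?R k))" .
  have "(f v - f u)\<^sup>2 \<le> (\<Sum>k < ?n. (?D k / sqrt (?R k))\<^sup>2) * (\<Sum>k < ?n. (sqrt (?R k))\<^sup>2)"
    unfolding sum by (rule Cauchy_Schwarz_ineq_sum)
  also have "\<dots> = (\<Sum>k < ?n. (?D k)\<^sup>2 / ?R k) * path_length R q"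
    using pos by (simp add: path_length_def power_divide less_imp_le)
  also have "\<dots> \<le> 2 * enn2real (energy V E R f) * path_length R q"
  proof (rule mult_right_mono)
    \<comment> \<open>Finiteness of the energy is what makes \<open>enn2real\<close> faithful here;
      infinite energy would be sent to 0.\<close>
    have "ennreal (\<Sum>k < ?n. (?D k)\<^sup>2 / ?R k) \<le> ennreal (2 * enn2real (energy V E R f))"
      using distinct_path_energy_le[OF q(1,2)] assms(1) by (simp add: ennreal_mult)
    then show "(\<Sum>k < ?n. (?D k)\<^sup>2 / ?R k) \<le> 2 * enn2real (energy V E R f)"
      by (subst (asm) ennreal_le_iff) auto
  qed (rule path_length_nonneg[OF q(1)])
  also have "\<dots> \<le> 2 * enn2real (energy V E R f) * path_length R p"
    using q(3) by (intro mult_left_mono) auto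
  finally show ?thesis .
qed

end

context connected_weighted_graph
begin

text \<open>The bound for a single path has a constant independent of the path, so it passes to the
  infimum.\<close>

lemma diff_square_le_graph_dist:
  assumes "energy V E R f < \<infinity>" "u \<in> V" "v \<in> V"
  shows "(f v - f u)\<^sup>2 \<le> 2 * enn2real (energy V E R f) * graph_dist V E R u v"
proof (cases "enn2real (energy V E R f) = 0")
  \<comment> \<open>The general case divides by the energy. If the energy is zero, the bound along
    any connecting path forces \<open>f u = f v\<close>.\<close>
  case True
  then show ?thesis
    using connected[OF assms(2,3)] path_diff_square_le[OF assms(1)] by fastforce
next
  case False
  then have M: "0 < 2 * enn2real (energy V E R f)"
    by (simp add: order_less_le)
  have "(f v - f u)\<^sup>2 / (2 * enn2real (energy V E R f)) \<le> graph_dist V E R u v"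
  proof (rule graph_dist_ge[OF assms(2,3)])
    fix p
    assume "is_path V E u p v"
    then show "(f v - f u)\<^sup>2 / (2 * enn2real (energy V E R f)) \<le> path_length R p"
      using path_diff_square_le[OF assms(1)] M by (simp add: pos_divide_le_eq mult.commute)
  qed
  with M show ?thesis by (simp add: pos_divide_le_eq mult.commute)
qed

lemma uniformly_continuous_map_finite_energy:
  assumes "energy V E R f < \<infinity>"
  shows "uniformly_continuous_map (graph_metric V E R) euclidean_metric f"
proof -
  define M where "M = 2 * enn2real (energy V E R f)"
  have "0 \<le> M" by (simp add: M_def)
  have "\<exists>\<delta>>0. \<forall>u\<in>V. \<forall>v\<in>V. graph_dist V E R v u < \<delta> \<longrightarrow> dist (f v) (f u) < \<epsilon>"
    if "0 < \<epsilon>" for \<epsilon>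
  \<comment> \<open>The square-root modulus of continuity suggests \<epsilon> squared over
    \<open>M\<close>; using \<open>M + 1\<close> keeps the denominator positive when
    \<open>M = 0\<close>.\<close>
  proof (intro exI[of _ "\<epsilon>\<^sup>2 / (M + 1)"] conjI ballI impI)
    show "0 < \<epsilon>\<^sup>2 / (M + 1)" using \<open>0 < \<epsilon>\<close> \<open>0 \<le> M\<close> by simp
    fix u v
    assume uv: "u \<in> V" "v \<in> V" and lt: "graph_dist V E R v u < \<epsilon>\<^sup>2 / (M + 1)"
    have nonneg: "0 \<le> graph_dist V E R v u"
      using Metric_space_graph_dist by (rule Metric_space.nonneg)
    have "(f u - f v)\<^sup>2 \<le> M * graph_dist V E R v u"
      unfolding M_def using assms uv by (intro diff_square_le_graph_dist) auto
    also have "\<dots> \<le> (M + 1) * graph_dist V E R v u"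
      using nonneg by (intro mult_right_mono) auto
    also have "\<dots> < \<epsilon>\<^sup>2"
      using lt \<open>0 \<le> M\<close> by (simp add: pos_less_divide_eq mult.commute)
    finally have "\<bar>f u - f v\<bar> < \<epsilon>"
      using \<open>0 < \<epsilon>\<close> by (metis abs_le_square_iff abs_of_pos linorder_not_less)
    then show "dist (f v) (f u) < \<epsilon>" by (simp add: dist_real_def abs_minus_commute)
  qed
  then show ?thesis by (simp add: uniformly_continuous_map_def)
qed

end

theorem theorem3p2:
  fixes V :: "'a set" and E :: "'a set set" and R :: "'a \<Rightarrow> 'a \<Rightarrow> real" and f :: "'a \<Rightarrow> real"
  assumes "connected_weighted_graph V E R"
    and "energy V E R f < \<infinity>"
  shows "uniformly_continuous_map (graph_metric V E R) euclidean_metric f \<and>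
    (\<forall>(Y :: 'b metric) \<iota>. is_metric_completion (graph_metric V E R) Y \<iota> \<longrightarrow>
      (\<exists>!g. g \<in> extensional (mspace Y) \<and>
        continuous_map (mtopology_of Y) euclideanreal g \<and> (\<forall>v \<in> V. g (\<iota> v) = f v)))"
proof -
  interpret connected_weighted_graph V E R by fact
  have uc: "uniformly_continuous_map (graph_metric V E R) euclidean_metric f"
    using assms(2) by (rule uniformly_continuous_map_finite_energy)
  \<comment> \<open>Completeness of the real line is what allows the extension lemma to be applied
    to an arbitrary completion \<open>Y\<close>.\<close>
  moreover have "mcomplete_of (euclidean_metric :: real metric)"
    by (simp add: mcomplete_of_def complete_UNIV)
  ultimately show ?thesis
    using metric_completion_extension[where Z = "euclidean_metric :: real metric"] by fastforce
qed

end
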